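(* Let $p_1(x),\dots,p_n(x)\in\mathbb{Q}[x]$ be non-constant pairwise relatively prime polynomials and let $f(x)\in\mathbb{Q}[x]$ satisfy $\deg f<\deg(p_1\cdots p_n)$. Then $$ f(x)\prod_{j=1}^n\frac{1}{p_j(x)}=\sum_{j=1}^n\frac{\mathrm{eval}\bigl(f(x)/g_j(x);\,p_j(x)\bigr)}{p_j(x)}, $$ where $g_j(x)=p_1(x)\cdots\widehat{p_j(x)}\cdots p_n(x)$, the hat meaning that the factor is omitted.
   Context: For $r(x),s(x),a(x)\in\mathbb{Q}[x]$ with $a$ non-constant and $\gcd(s,a)=1$, $\mathrm{eval}\left(\frac{r(x)}{s(x)};a(x)\right)$ is the remainder of $\alpha(x)r(x)$ on division by $a(x)$, where $\alpha(x)\in\mathbb{Q}[x]$ satisfies $\alpha(x)s(x)\equiv1\pmod{a(x)}$. *)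

theory Defs
  imports
    "HOL-Computational_Algebra.Computational_Algebra"
    "HOL-Number_Theory.Cong"
begin

text \<open>
  \<open>ratfun_eval q a\<close> is eval(q; a) for a rational function \<open>q = r/s\<close> with \<open>s\<close> coprime to the
  non-constant polynomial \<open>a\<close>.  Neither the choice of the representation \<open>r/s\<close> nor that of
  the inverse \<open>\<alpha>\<close> of \<open>s\<close> modulo \<open>a\<close> matters (see \<open>ratfun_eval_eq\<close>), so the description is
  proper; if no such representation exists, the value is unspecified.
\<close>

definition ratfun_eval :: "rat poly fract \<Rightarrow> rat poly \<Rightarrow> rat poly" where
  "ratfun_eval q a = (THE \<rho>. \<exists>r s \<alpha>. s \<noteq> 0 \<and> q = Fract r s \<and> coprime s a \<and>
     [\<alpha> * s = 1] (mod a) \<and> \<rho> = (\<alpha> * r) mod a)"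

lemma ratfun_eval_eq:
  fixes r s a \<alpha> :: "rat poly"
  assumes "s \<noteq> 0" "coprime s a" "[\<alpha> * s = 1] (mod a)"
  shows "ratfun_eval (Fract r s) a = (\<alpha> * r) mod a"
  unfolding ratfun_eval_def
proof (rule the_equality)
  show "\<exists>r' s' \<alpha>'. s' \<noteq> 0 \<and> Fract r s = Fract r' s' \<and> coprime s' a \<and>
      [\<alpha>' * s' = 1] (mod a) \<and> \<alpha> * r mod a = (\<alpha>' * r') mod a"
    using assms by blast
next
  fix \<rho>
  assume "\<exists>r' s' \<alpha>'. s' \<noteq> 0 \<and> Fract r s = Fract r' s' \<and> coprime s' a \<and>
      [\<alpha>' * s' = 1] (mod a) \<and> \<rho> = (\<alpha>' * r') mod a"
  then obtain r' s' \<alpha>' where *: "s' \<noteq> 0" "Fract r s = Fract r' s'"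
      "[\<alpha>' * s' = 1] (mod a)" "\<rho> = (\<alpha>' * r') mod a"
    by blast
  have eq: "r * s' = r' * s"
    using * assms(1) by (simp add: eq_fract)
  have "[\<alpha>' * r' * (\<alpha> * s) = \<alpha>' * r' * 1] (mod a)"
    using assms(3) by (rule cong_scalar_left)
  moreover have "[\<alpha> * r * (\<alpha>' * s') = \<alpha> * r * 1] (mod a)"
    using *(3) by (rule cong_scalar_left)
  moreover have "\<alpha>' * r' * (\<alpha> * s) = \<alpha> * \<alpha>' * (r' * s)" "\<alpha> * r * (\<alpha>' * s') = \<alpha> * \<alpha>' * (r * s')"
    by (simp_all only: mult_ac)
  ultimately have "[\<alpha>' * r' = \<alpha> * r] (mod a)"
    using eq by (metis cong_sym cong_trans mult_1_right)
  then show "\<rho> = \<alpha> * r mod a"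
    using *(4) by (simp add: cong_def)
qed

end

theory Submission
  imports
    Defs
    "HOL-Computational_Algebra.Field_as_Ring"
begin

text \<open>
  Write \<open>g\<^sub>j\<close> for the product of the \<open>p\<^sub>i\<close> with \<open>i \<noteq> j\<close> and \<open>e\<^sub>j\<close> for \<open>eval(f/g\<^sub>j; p\<^sub>j)\<close>.  After
  multiplication by \<open>\<Prod>i. p\<^sub>i\<close> the identity reads \<open>f = (\<Sum>j. e\<^sub>j g\<^sub>j)\<close>, which is Lagrange
  interpolation with the moduli \<open>p\<^sub>j\<close> in place of linear factors.  The evaluation is made so that
  \<open>e\<^sub>j g\<^sub>j \<equiv> f\<close> modulo \<open>p\<^sub>j\<close> and \<open>deg e\<^sub>j < deg p\<^sub>j\<close> (\<open>cong_ratfun_eval\<close>, \<open>degree_ratfun_eval\<close>).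
  The terms with another index vanish modulo \<open>p\<^sub>j\<close>, because \<open>p\<^sub>j\<close> divides their \<open>g\<^sub>i\<close>; so both sides
  agree modulo every \<open>p\<^sub>j\<close>, hence modulo the product of these coprime moduli.  Both have degree
  less than that product, so they are equal (\<open>sum_mult_complementary_prod_eq\<close>).
\<close>

text \<open>
  The evaluation is specified only when an inverse of the denominator modulo \<open>a\<close> exists; for a
  denominator coprime to \<open>a\<close>, Bezout's identity provides one.
\<close>

lemma ratfun_eval_divide_eq_mod:
  fixes f g a :: "rat poly"
  assumes "g \<noteq> 0" "coprime g a"
  obtains \<alpha> where "[\<alpha> * g = 1] (mod a)"
    "ratfun_eval (to_fract f / to_fract g) a = (\<alpha> * f) mod a"
proof -
  obtain \<alpha> \<beta> where "bezout_coefficients g a = (\<alpha>, \<beta>)"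
    by fastforce
  then have "\<alpha> * g + \<beta> * a = 1"
    using bezout_coefficients[of g a \<alpha> \<beta>] assms(2) by simp
  then have inv: "[\<alpha> * g = 1] (mod a)"
    by (metis cong_def mod_mult_self1)
  have "to_fract f / to_fract g = Fract f g"
    using assms(1) by (simp add: to_fract_def)
  with inv show thesis
    using that ratfun_eval_eq[OF assms inv] by simp
qed

lemma cong_ratfun_eval:
  fixes f g a :: "rat poly"
  assumes "g \<noteq> 0" "coprime g a"
  shows "[ratfun_eval (to_fract f / to_fract g) a * g = f] (mod a)"
proof -
  obtain \<alpha> where inv: "[\<alpha> * g = 1] (mod a)"
    and eval: "ratfun_eval (to_fract f / to_fract g) a = (\<alpha> * f) mod a"
    using ratfun_eval_divide_eq_mod[OF assms] .
  have "[(\<alpha> * f) mod a * g = \<alpha> * f * g] (mod a)"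
    by (simp add: cong_def mod_mult_left_eq)
  also have "\<alpha> * f * g = f * (\<alpha> * g)"
    by (simp add: mult_ac)
  also have "[f * (\<alpha> * g) = f * 1] (mod a)"
    using inv by (rule cong_scalar_left)
  finally show ?thesis
    by (simp add: eval)
qed

lemma degree_ratfun_eval:
  fixes f g a :: "rat poly"
  assumes "g \<noteq> 0" "coprime g a" "0 < degree a"
  shows "degree (ratfun_eval (to_fract f / to_fract g) a) < degree a"
proof -
  obtain \<alpha> where "ratfun_eval (to_fract f / to_fract g) a = (\<alpha> * f) mod a"
    using ratfun_eval_divide_eq_mod[OF assms(1,2)] .
  \<comment> \<open>The zero remainder has degree \<open>0\<close> too, which is why \<open>a\<close> must be non-constant.\<close>
  moreover have "degree ((\<alpha> * f) mod a) < degree a"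
    using assms(3) degree_mod_less[of a "\<alpha> * f"] by (cases "a = 0") auto
  ultimately show ?thesis
    by simp
qed

lemma to_fract_prod: "to_fract (prod f A) = (\<Prod>x\<in>A. to_fract (f x))"
  by (induction A rule: infinite_finite_induct) simp_all

lemma prod_dvd_of_pairwise_coprime:
  fixes p :: "'i \<Rightarrow> 'a :: semiring_gcd"
  assumes "\<And>i j. i \<in> A \<Longrightarrow> j \<in> A \<Longrightarrow> i \<noteq> j \<Longrightarrow> coprime (p i) (p j)"
    and "\<And>j. j \<in> A \<Longrightarrow> p j dvd x"
  shows "prod p A dvd x"
  using assms
proof (induction A rule: infinite_finite_induct)
  case (insert j A)
  have "coprime (p j) (prod p A)"
    using insert.prems(1) insert.hyps(2) by (intro prod_coprime_right) auto
  with insert show ?case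
    by (auto intro: divides_mult)
qed simp_all

text \<open>
  Lagrange interpolation: a sum of this shape is determined by its residues modulo the \<open>p j\<close>,
  because its degree is too small for a nonzero multiple of their product to be added.
\<close>

lemma sum_mult_complementary_prod_eq:
  fixes p e :: "'i \<Rightarrow> 'a :: field_gcd poly" and f :: "'a poly"
  assumes fin: "finite A"
    and nz: "\<And>j. j \<in> A \<Longrightarrow> p j \<noteq> 0"
    and coprime: "\<And>i j. i \<in> A \<Longrightarrow> j \<in> A \<Longrightarrow> i \<noteq> j \<Longrightarrow> coprime (p i) (p j)"
    and deg_f: "degree f < degree (\<Prod>j\<in>A. p j)"
    and deg_e: "\<And>j. j \<in> A \<Longrightarrow> degree (e j) < degree (p j)"
    and cong: "\<And>j. j \<in> A \<Longrightarrow> [e j * (\<Prod>i\<in>A - {j}. p i) = f] (mod p j)"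
  shows "(\<Sum>j\<in>A. e j * (\<Prod>i\<in>A - {j}. p i)) = f"
proof -
  define F where "F = (\<Sum>j\<in>A. e j * (\<Prod>i\<in>A - {j}. p i))"
  have "p j dvd F - f" if "j \<in> A" for j
  proof -
    have "F = e j * (\<Prod>i\<in>A - {j}. p i) + (\<Sum>k\<in>A - {j}. e k * (\<Prod>i\<in>A - {k}. p i))"
      unfolding F_def using fin that by (rule sum.remove)
    then have "F - f = (e j * (\<Prod>i\<in>A - {j}. p i) - f) +
        (\<Sum>k\<in>A - {j}. e k * (\<Prod>i\<in>A - {k}. p i))"
      by simp
    moreover have "p j dvd (\<Sum>k\<in>A - {j}. e k * (\<Prod>i\<in>A - {k}. p i))"
      using fin that by (intro dvd_sum dvd_mult dvd_prodI) auto
    moreover have "p j dvd e j * (\<Prod>i\<in>A - {j}. p i) - f"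
      using cong[OF that] by (simp add: cong_iff_dvd_diff)
    ultimately show ?thesis
      by (simp only: dvd_add)
  qed
  then have dvd: "(\<Prod>j\<in>A. p j) dvd F - f"
    using coprime by (intro prod_dvd_of_pairwise_coprime) auto
  have "degree (e j * (\<Prod>i\<in>A - {j}. p i)) < degree (\<Prod>j\<in>A. p j)" if "j \<in> A" for j
  proof -
    have "degree (e j * (\<Prod>i\<in>A - {j}. p i)) \<le> degree (e j) + degree (\<Prod>i\<in>A - {j}. p i)"
      by (rule degree_mult_le)
    also have "\<dots> < degree (p j) + degree (\<Prod>i\<in>A - {j}. p i)"
      using deg_e[OF that] by simp
    also have "\<dots> = degree (p j * (\<Prod>i\<in>A - {j}. p i))"
      using nz that fin by (subst degree_mult_eq) auto
    also have "\<dots> = degree (\<Prod>j\<in>A. p j)"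
      using fin that by (simp add: prod.remove)
    finally show ?thesis .
  qed
  then have "degree F < degree (\<Prod>j\<in>A. p j)"
    unfolding F_def using deg_f by (intro degree_sum_less) auto
  then have "degree (F - f) < degree (\<Prod>j\<in>A. p j)"
    using deg_f by (rule degree_diff_less)
  with dvd have "F - f = 0"
    using dvd_imp_degree_le leD by blast
  then show ?thesis
    by (simp add: F_def)
qed

theorem theorem1p2p1:
  fixes n :: nat and p :: "nat \<Rightarrow> rat poly" and f :: "rat poly"
  assumes "1 \<le> n"
    and "\<And>j. j \<in> {1..n} \<Longrightarrow> 0 < degree (p j)"
    and "\<And>i j. i \<in> {1..n} \<Longrightarrow> j \<in> {1..n} \<Longrightarrow> i \<noteq> j \<Longrightarrow> coprime (p i) (p j)"
    and "degree f < degree (\<Prod>j=1..n. p j)"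
  shows "to_fract f * (\<Prod>j=1..n. 1 / to_fract (p j)) =
    (\<Sum>j=1..n.
      to_fract (ratfun_eval (to_fract f / to_fract (\<Prod>i\<in>{1..n} - {j}. p i)) (p j))
        / to_fract (p j))"
proof -
  define g where "g j = (\<Prod>i\<in>{1..n} - {j}. p i)" for j
  define e where "e j = ratfun_eval (to_fract f / to_fract (g j)) (p j)" for j
  let ?P = "\<Prod>j=1..n. p j"
  have nz: "p j \<noteq> 0" if "j \<in> {1..n}" for j
    using assms(2)[OF that] by auto
  have g_nz: "g j \<noteq> 0" for j
    using nz by (auto simp: g_def)
  have g_coprime: "coprime (g j) (p j)" if "j \<in> {1..n}" for j
    unfolding g_def using that assms(3) by (intro prod_coprime_left) auto
  have P: "?P = p j * g j" if "j \<in> {1..n}" for j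
    unfolding g_def using that by (intro prod.remove) auto
  have "(\<Sum>j=1..n. e j * g j) = f"
    unfolding g_def
  proof (rule sum_mult_complementary_prod_eq)
    fix j assume j: "j \<in> {1..n}"
    show "degree (e j) < degree (p j)"
      unfolding e_def using g_nz g_coprime[OF j] assms(2)[OF j] by (rule degree_ratfun_eval)
    show "[e j * (\<Prod>i\<in>{1..n} - {j}. p i) = f] (mod p j)"
      unfolding e_def g_def[symmetric] using g_nz g_coprime[OF j] by (rule cong_ratfun_eval)
  qed (use nz assms in auto)
  then have "to_fract f = (\<Sum>j=1..n. to_fract (e j) * to_fract (g j))"
    unfolding to_fract_mult[symmetric] to_fract_sum[symmetric] by simp
  moreover have "(\<Prod>j=1..n. 1 / to_fract (p j)) = 1 / to_fract ?P"
    by (simp add: prod_dividef to_fract_prod)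
  ultimately have "to_fract f * (\<Prod>j=1..n. 1 / to_fract (p j)) =
      (\<Sum>j=1..n. to_fract (e j) * to_fract (g j) / to_fract ?P)"
    by (simp add: sum_divide_distrib)
  also have "\<dots> = (\<Sum>j=1..n. to_fract (e j) / to_fract (p j))"
    using P g_nz nz by (intro sum.cong) auto
  finally show ?thesis
    by (simp add: e_def g_def)
qed

end
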